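(* Let $A\in\mathbb{R}^{m\times n}$ and $b\in\mathbb{R}^m$ be such that $Ax=b$ is consistent, let $x^*\in\mathbb{R}^n$ be any vector with $Ax^*=b$, let $B\in\mathbb{R}^{n\times n}$ be symmetric positive definite, let $S\in\mathbb{R}^{m\times q}$ be (a realization of) the sampling matrix, and let $x^k\in\mathbb{R}^n$. Then the following six descriptions are equivalent: each of them determines a point $x^{k+1}\in\mathbb{R}^n$ uniquely, and all six produce the same point. 1. (Sketch-and-project) $x^{k+1}=\arg\min_{x\in\mathbb{R}^n}\|x-x^k\|_B^2$ subject to $S^TAx=S^Tb$. 2. (Constrain-and-approximate) $x^{k+1}=\arg\min_{x\in\mathbb{R}^n}\|x-x^*\|_B^2$ subject to $x=x^k+B^{-1}A^TSy$, with $y\in\mathbb{R}^q$ free. 3. (Random intersect) $\{x^{k+1}\}=\left(x^*+\mathrm{Null}(S^TA)\right)\cap\left(x^k+\mathrm{Range}(B^{-1}A^TS)\right)$. 4. (Random linear solve) $x^{k+1}$ is the $x$-component of a solution $(x,y)\in\mathbb{R}^n\times\mathbb{R}^q$ of the linear system $S^TAx=S^Tb$, $x=x^k+B^{-1}A^TSy$ (the $x$-component being unique). 5. (Random update) $x^{k+1}=x^k-B^{-1}A^TS(S^TAB^{-1}A^TS)^{\dagger}S^T(Ax^k-b)$. 6. (Random fixed point) $x^{k+1}-x^*=(I-B^{-1}Z)(x^k-x^* )$, where $Z=A^TS(S^TAB^{-1}A^TS)^{\dagger}S^TA$.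
   Context: $M^\dagger$ denotes the Moore-Penrose pseudoinverse of a real matrix $M$. For the symmetric positive definite matrix $B$, $\langle x,y\rangle_B=x^TBy$ and $\|x\|_B=\sqrt{\langle x,x\rangle_B}$ for $x,y\in\mathbb{R}^n$. $\mathrm{Null}(M)$ and $\mathrm{Range}(M)$ denote the null space and the range (column space) of $M$, and $I$ is the $n\times n$ identity matrix. *)

theory Defs
  imports "HOL-Analysis.Analysis"
begin

definition sym_pos_def :: "real^'n^'n \<Rightarrow> bool" where
  "sym_pos_def B \<longleftrightarrow> transpose B = B \<and> (\<forall>x. x \<noteq> 0 \<longrightarrow> x \<bullet> (B *v x) > 0)"

definition inner_mat :: "real^'n^'n \<Rightarrow> real^'n \<Rightarrow> real^'n \<Rightarrow> real" where
  "inner_mat B x y = x \<bullet> (B *v y)"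

definition norm_mat :: "real^'n^'n \<Rightarrow> real^'n \<Rightarrow> real" where
  "norm_mat B x = sqrt (inner_mat B x x)"

text \<open>The four Penrose equations. Every real matrix \<open>M\<close> has exactly one solution \<open>X\<close> of them, so
  the definite description in \<open>pinv\<close> always denotes.\<close>

definition is_pinv :: "real^'n^'m \<Rightarrow> real^'m^'n \<Rightarrow> bool" where
  "is_pinv M X \<longleftrightarrow>
     M ** X ** M = M \<and>
     X ** M ** X = X \<and>
     transpose (M ** X) = M ** X \<and>
     transpose (X ** M) = X ** M"

definition pinv :: "real^'n^'m \<Rightarrow> real^'m^'n" where
  "pinv M = (THE X. is_pinv M X)"

definition null_mat :: "real^'n^'m \<Rightarrow> (real^'n) set" where
  "null_mat M = {x. M *v x = 0}"

definition range_mat :: "real^'n^'m \<Rightarrow> (real^'m) set" where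
  "range_mat M = range (\<lambda>x. M *v x)"

end

theory Submission
  imports Defs
begin

(* With W = S^T A, C = B^-1 W^T and M = W C, the point p = xk - C M^+ W (xk - xstar) lies both in
   xstar + Null W and in xk + Range C, because M M^+ W = W. These two affine spaces are orthogonal
   in the B-inner product, so p is their only common point, and Pythagoras makes p the B-nearest
   point to xk in the first and to xstar in the second. *)

subsection \<open>Moore-Penrose pseudoinverse\<close>

lemma matrix_diff_ldistrib: "A ** (B - C) = A ** B - A ** C"
  for A :: "'a::ring_1^'n^'m"
  by (simp add: matrix_eq algebra_simps flip: matrix_vector_mul_assoc)

lemma matrix_diff_rdistrib: "(A - B) ** C = A ** C - B ** C"
  for A :: "'a::ring_1^'n^'m"
  by (simp add: matrix_eq algebra_simps flip: matrix_vector_mul_assoc)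

lemma transpose_0: "transpose (0 :: 'a::zero^'n^'m) = 0"
  by (simp add: vec_eq_iff transpose_def)

text \<open>For each \<open>x\<close>, the squared length of \<open>D *v x\<close> is the quadratic
  form of \<open>transpose D ** D\<close> at \<open>x\<close>.\<close>

lemma transpose_mult_self_eq_0:
  fixes D :: "real^'n^'m"
  assumes "transpose D ** D = 0"
  shows "D = 0"
proof -
  have "D *v x = 0" for x
  proof -
    have "(D *v x) \<bullet> (D *v x) = x \<bullet> ((transpose D ** D) *v x)"
      by (metis dot_lmul_matrix inner_commute matrix_vector_mul_assoc transpose_matrix_vector transpose_transpose)
    then show ?thesis using assms by simp
  qed
  then show ?thesis by (simp add: matrix_eq)
qed

text \<open>\<open>G\<close> is the matrix of a linear right inverse of \<open>M\<close> on its
  range.\<close>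

lemma generalized_inverse_exists:
  fixes M :: "real^'n^'m"
  obtains G :: "real^'m^'n" where "M ** G ** M = M"
proof -
  obtain g where g: "linear g" "\<And>v. v \<in> range ((*v) M) \<Longrightarrow> M *v g v = v"
    using linear_exists_right_inverse_on[OF matrix_vector_mul_linear subspace_UNIV, of M] by blast
  have "M ** matrix g ** M = M"
    by (simp add: matrix_eq matrix_vector_mul(2)[OF g(1)] g(2) flip: matrix_vector_mul_assoc)
  then show ?thesis by (rule that)
qed

(* M G M^T is the orthogonal projection onto the range of M. *)
lemma range_projection_exists:
  fixes M :: "real^'n^'m"
  obtains G :: "real^'n^'n" where
    "M ** G ** transpose M ** M = M" "transpose (M ** G ** transpose M) = M ** G ** transpose M"
proof -
  \<comment> \<open>\<open>G\<close> is a generalized inverse of the Gram matrix. To cancel the left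
    factor \<open>transpose M\<close>, note that \<open>?D\<close> is \<open>M\<close> times a
    matrix, so \<open>transpose ?D ** ?D\<close> contains \<open>transpose M ** ?D\<close>.\<close>
  obtain G where G: "transpose M ** M ** G ** (transpose M ** M) = transpose M ** M"
    by (rule generalized_inverse_exists)
  let ?D = "M ** G ** transpose M ** M - M"
  have "transpose M ** ?D = 0"
    using G by (simp add: matrix_diff_ldistrib matrix_mul_assoc)
  moreover have "transpose ?D = transpose (G ** transpose M ** M - mat 1) ** transpose M"
    by (simp add: matrix_diff_ldistrib matrix_mul_assoc flip: matrix_transpose_mul)
  ultimately have "transpose ?D ** ?D = 0"
    by (simp flip: matrix_mul_assoc)
  then have M: "M ** G ** transpose M ** M = M"
    using transpose_mult_self_eq_0 by fastforce
  let ?U = "M ** G ** transpose M"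
  \<comment> \<open>\<open>?U ** transpose ?U\<close> is symmetric, so showing that it equals
    \<open>transpose ?U\<close> makes \<open>?U\<close> symmetric.\<close>
  have "?U ** transpose ?U = (?U ** M) ** (transpose G ** transpose M)"
    by (simp only: matrix_transpose_mul transpose_transpose matrix_mul_assoc)
  also have "\<dots> = transpose ?U"
    by (simp only: M matrix_transpose_mul transpose_transpose matrix_mul_assoc)
  finally have "transpose ?U = ?U"
    by (metis matrix_transpose_mul transpose_transpose)
  with M show ?thesis by (rule that)
qed

lemma is_pinv_exists:
  fixes M :: "real^'n^'m"
  shows "\<exists>X. is_pinv M X"
proof -
  obtain G where G: "M ** G ** transpose M ** M = M"
      "transpose (M ** G ** transpose M) = M ** G ** transpose M"
    by (rule range_projection_exists)
  \<comment> \<open>\<open>transpose M ** H ** M\<close> is the orthogonal projection onto the row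
    space of \<open>M\<close>.\<close>
  obtain H where H: "transpose M ** H ** M ** transpose M = transpose M"
      "transpose (transpose M ** H ** M) = transpose M ** H ** M"
    using range_projection_exists[of "transpose M"] by (metis transpose_transpose)
  have MV: "M ** transpose M ** H ** M = M"
    using arg_cong[OF H(1), of transpose] H(2)
    by (metis matrix_transpose_mul transpose_transpose matrix_mul_assoc)
  \<comment> \<open>The row space projection times \<open>G ** transpose M\<close>: with this choice
    \<open>M ** ?X\<close> and \<open>?X ** M\<close> are the projections onto the range and the row
    space.\<close>
  let ?X = "transpose M ** H ** M ** G ** transpose M"
  have MX: "M ** ?X = M ** G ** transpose M"
    by (simp add: MV matrix_mul_assoc)
  have XM: "?X ** M = transpose M ** H ** M"
    using arg_cong[OF G(1), of "\<lambda>N. transpose M ** H ** N"] by (simp add: matrix_mul_assoc)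
  have "?X ** M ** ?X = ?X"
    unfolding XM using arg_cong[OF H(1), of "\<lambda>N. N ** H ** M ** G ** transpose M"]
    by (simp add: matrix_mul_assoc)
  then have "is_pinv M ?X"
    unfolding is_pinv_def MX XM using G H by simp
  then show ?thesis ..
qed

text \<open>The products \<open>M ** X\<close> and \<open>X ** M\<close> are orthogonal projections
  fixed by \<open>M\<close> alone, and they determine \<open>X\<close> through
  \<open>X = X ** M ** X\<close>.\<close>

lemma is_pinv_unique:
  assumes X: "is_pinv M X" and Y: "is_pinv M Y"
  shows "X = Y"
proof -
  have "M ** X = M ** Y"
  proof -
    have "M ** X = transpose (M ** Y ** (M ** X))"
      using X Y by (simp add: is_pinv_def matrix_mul_assoc)
    also have "\<dots> = M ** X ** (M ** Y)"
      using X Y unfolding is_pinv_def by (metis matrix_transpose_mul)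
    also have "\<dots> = M ** Y"
      using X by (simp add: is_pinv_def matrix_mul_assoc)
    finally show ?thesis .
  qed
  moreover have "X ** M = Y ** M"
  proof -
    have "X ** M = transpose (X ** M ** (Y ** M))"
      using X Y by (simp add: is_pinv_def flip: matrix_mul_assoc)
    also have "\<dots> = Y ** M ** (X ** M)"
      using X Y unfolding is_pinv_def by (metis matrix_transpose_mul)
    also have "\<dots> = Y ** M"
      using X by (simp add: is_pinv_def flip: matrix_mul_assoc)
    finally show ?thesis .
  qed
  ultimately show ?thesis
    using X Y unfolding is_pinv_def by (metis matrix_mul_assoc)
qed

lemma is_pinv_pinv: "is_pinv M (pinv M)"
  unfolding pinv_def by (rule theI') (use is_pinv_exists is_pinv_unique in blast)

subsection \<open>Symmetric positive definite matrices\<close>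

lemma sym_pos_def_inv:
  assumes "sym_pos_def B"
  shows "B ** matrix_inv B = mat 1" "matrix_inv B ** B = mat 1" "sym_pos_def (matrix_inv B)"
proof -
  have "x = 0" if "B *v x = 0" for x
    using assms that unfolding sym_pos_def_def by (metis inner_zero_right less_irrefl)
  then have "invertible B"
    by (simp add: invertible_left_inverse matrix_left_invertible_ker)
  then show BI: "B ** matrix_inv B = mat 1" and IB: "matrix_inv B ** B = mat 1"
    unfolding invertible_def matrix_inv_def by (metis (mono_tags, lifting) someI_ex)+
  \<comment> \<open>The transpose of the inverse is also a left inverse of \<open>B\<close>, hence
    equals the inverse.\<close>
  have "transpose (matrix_inv B) ** B = mat 1"
    using arg_cong[OF BI, of transpose] assms by (simp add: matrix_transpose_mul sym_pos_def_def)
  then have "transpose (matrix_inv B) = matrix_inv B"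
    by (metis BI matrix_mul_assoc matrix_mul_lid matrix_mul_rid)
  moreover have "x \<bullet> (matrix_inv B *v x) > 0" if "x \<noteq> 0" for x
  proof -
    \<comment> \<open>This substitution turns the quadratic form of the inverse at \<open>x\<close>
      into that of \<open>B\<close> at \<open>u\<close>.\<close>
    define u where "u = matrix_inv B *v x"
    have x: "x = B *v u" by (simp add: u_def matrix_vector_mul_assoc BI)
    then have "u \<noteq> 0" using that by auto
    then have "u \<bullet> (B *v u) > 0" using assms by (simp add: sym_pos_def_def)
    then show ?thesis by (metis x u_def inner_commute)
  qed
  ultimately show "sym_pos_def (matrix_inv B)" by (simp add: sym_pos_def_def)
qed

lemma sym_pos_def_congruence_kernel:
  fixes P :: "real^'n^'n" and W :: "real^'n^'q"
  assumes P: "sym_pos_def P" and d: "(W ** P ** transpose W) *v d = 0"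
  shows "transpose W *v d = 0"
proof (rule ccontr)
  assume "transpose W *v d \<noteq> 0"
  then have "(transpose W *v d) \<bullet> (P *v (transpose W *v d)) > 0"
    using P by (simp add: sym_pos_def_def)
  also have "(transpose W *v d) \<bullet> (P *v (transpose W *v d)) = d \<bullet> ((W ** P ** transpose W) *v d)"
    by (simp add: transpose_matrix_vector dot_lmul_matrix flip: matrix_vector_mul_assoc)
  finally show False using d by simp
qed

text \<open>Since \<open>?E ** M = 0\<close>, the symmetric \<open>M\<close> annihilates the columns
  of \<open>transpose ?E\<close>. Its kernel lies in that of \<open>transpose W\<close>, so
  \<open>transpose W\<close> annihilates them too; transposing back gives
  \<open>?E ** W = 0\<close>.\<close>

lemma pinv_congruence_absorb:
  fixes P :: "real^'n^'n" and W :: "real^'n^'q"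
  assumes P: "sym_pos_def P"
  defines "M \<equiv> W ** P ** transpose W"
  shows "M ** pinv M ** W = W"
proof -
  let ?E = "M ** pinv M - mat 1"
  have "transpose M = M"
    using P by (simp add: M_def sym_pos_def_def matrix_transpose_mul matrix_mul_assoc)
  have "?E ** M = 0"
    using is_pinv_pinv[of M] by (simp add: is_pinv_def matrix_diff_rdistrib)
  from arg_cong[OF this, of transpose] have "M ** transpose ?E = 0"
    by (simp add: matrix_transpose_mul transpose_0 \<open>transpose M = M\<close>)
  then have "transpose W *v (transpose ?E *v y) = 0" for y
    by (intro sym_pos_def_congruence_kernel[OF P])
       (simp add: matrix_vector_mul_assoc del: transpose_matrix_vector flip: M_def)
  then have "transpose W ** transpose ?E = 0"
    by (simp add: matrix_eq flip: matrix_vector_mul_assoc)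
  from arg_cong[OF this, of transpose] have "?E ** W = 0"
    by (simp add: matrix_transpose_mul transpose_0)
  then show ?thesis by (simp add: matrix_diff_rdistrib)
qed

section \<open>Geometry of the B-norm\<close>

lemma norm_mat_sq:
  assumes "sym_pos_def B"
  shows "(norm_mat B x)\<^sup>2 = x \<bullet> (B *v x)"
proof -
  have "x \<bullet> (B *v x) \<ge> 0"
    using assms by (cases "x = 0") (auto simp: sym_pos_def_def less_imp_le)
  then show ?thesis by (simp add: norm_mat_def inner_mat_def)
qed

lemma norm_mat_pythagoras:
  assumes B: "sym_pos_def B" and uv: "u \<bullet> (B *v v) = 0"
  shows "(norm_mat B (u + v))\<^sup>2 = (norm_mat B u)\<^sup>2 + (norm_mat B v)\<^sup>2"
proof -
  have "v \<bullet> (B *v u) = u \<bullet> (B *v v)"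
    using B unfolding sym_pos_def_def
    by (metis dot_lmul_matrix inner_commute transpose_matrix_vector)
  then show ?thesis
    using uv by (simp add: norm_mat_sq[OF B] algebra_simps inner_simps matrix_vector_right_distrib)
qed

text \<open>By Pythagoras the objective on the feasible set is a constant plus the squared
  B-distance to \<open>p\<close>, which vanishes only at \<open>p\<close>.\<close>

lemma is_arg_min_norm_mat_iff:
  assumes B: "sym_pos_def B" and "P p"
    and orth: "\<And>z. P z \<Longrightarrow> (z - p) \<bullet> (B *v (p - a)) = 0"
  shows "is_arg_min (\<lambda>z. (norm_mat B (z - a))\<^sup>2) P x \<longleftrightarrow> x = p"
proof -
  have eq: "(norm_mat B (z - a))\<^sup>2 = (norm_mat B (z - p))\<^sup>2 + (norm_mat B (p - a))\<^sup>2" if "P z" for z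
    using norm_mat_pythagoras[OF B orth[OF that]] by simp
  have "(norm_mat B (z - p))\<^sup>2 > 0" if "z \<noteq> p" for z
    using B that by (simp add: norm_mat_sq[OF B] sym_pos_def_def)
  then show ?thesis
    unfolding is_arg_min_def using \<open>P p\<close> eq by (smt (verit) zero_le_power2)
qed

subsection \<open>Sketch-and-project\<close>

theorem theorem2p1:
  fixes A :: "real^'n^'m"
    and B :: "real^'n^'n"
    and S :: "real^'q^'m"
    and b :: "real^'m"
    and xstar xk :: "real^'n"
  assumes consistent: "\<exists>x. A *v x = b"
    and xstar: "A *v xstar = b"
    and B: "sym_pos_def B"
  shows "\<exists>p. \<forall>x.
    (is_arg_min (\<lambda>z. (norm_mat B (z - xk))\<^sup>2)
        (\<lambda>z. (transpose S ** A) *v z = transpose S *v b) x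
      \<longleftrightarrow> x = p) \<and>
    (is_arg_min (\<lambda>z. (norm_mat B (z - xstar))\<^sup>2)
        (\<lambda>z. \<exists>y. z = xk + (matrix_inv B ** transpose A ** S) *v y) x
      \<longleftrightarrow> x = p) \<and>
    ({x} = ((\<lambda>u. xstar + u) ` null_mat (transpose S ** A)) \<inter>
           ((\<lambda>u. xk + u) ` range_mat (matrix_inv B ** transpose A ** S))
      \<longleftrightarrow> x = p) \<and>
    ((\<exists>y. (transpose S ** A) *v x = transpose S *v b \<and>
          x = xk + (matrix_inv B ** transpose A ** S) *v y)
      \<longleftrightarrow> x = p) \<and>
    (x = xk - (matrix_inv B ** transpose A ** S **
               pinv (transpose S ** A ** matrix_inv B ** transpose A ** S) **
               transpose S) *v (A *v xk - b)
      \<longleftrightarrow> x = p) \<and>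
    ((let Z = transpose A ** S **
              pinv (transpose S ** A ** matrix_inv B ** transpose A ** S) **
              transpose S ** A
      in x - xstar = (mat 1 - matrix_inv B ** Z) *v (xk - xstar))
      \<longleftrightarrow> x = p)"
proof -
  let ?Bi = "matrix_inv B"
  define W where "W = transpose S ** A"
  define C where "C = ?Bi ** transpose A ** S"
  define M where "M = transpose S ** A ** ?Bi ** transpose A ** S"
  \<comment> \<open>The random update, with the residual \<open>A *v xk - b\<close> rewritten as
    \<open>A *v (xk - xstar)\<close>.\<close>
  define p where "p = xk - C *v (pinv M *v (W *v (xk - xstar)))"
  note Bi = sym_pos_def_inv[OF B]
  have TW: "transpose W = transpose A ** S"
    by (simp add: W_def matrix_transpose_mul)
  have CW: "C = ?Bi ** transpose W"
    by (simp add: C_def TW matrix_mul_assoc)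
  have M: "M = W ** ?Bi ** transpose W"
    by (simp add: M_def W_def TW[unfolded W_def] matrix_mul_assoc)
  have WC: "W ** C = M"
    by (simp add: CW M matrix_mul_assoc)
  have MMW: "M ** pinv M ** W = W"
    unfolding M by (rule pinv_congruence_absorb[OF Bi(3)])
  have Sb: "transpose S *v b = W *v xstar"
    by (simp add: W_def xstar flip: matrix_vector_mul_assoc)
  have Wp: "W *v p = W *v xstar"
  proof -
    have "W *v (C *v (pinv M *v (W *v (xk - xstar)))) = W *v (xk - xstar)"
      by (simp add: matrix_vector_mul_assoc matrix_mul_assoc WC MMW)
    then show ?thesis
      by (simp add: p_def matrix_vector_mult_diff_distrib)
  qed
  obtain yp where yp: "p = xk + C *v yp"
    by (rule that[of "- (pinv M *v (W *v (xk - xstar)))"])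
       (simp add: p_def linear_neg)
  \<comment> \<open>Null W is B-orthogonal to Range C, because \<open>B\<close> cancels the inverse
    in \<open>C\<close> and leaves \<open>transpose W\<close>.\<close>
  have orth: "u \<bullet> (B *v (C *v y)) = 0" if "W *v u = 0" for u y
  proof -
    have "B ** C = transpose W"
      by (simp add: CW matrix_mul_assoc Bi)
    then have "u \<bullet> (B *v (C *v y)) = (W *v u) \<bullet> y"
      by (simp add: matrix_vector_mul_assoc)
         (metis dot_lmul_matrix inner_commute transpose_matrix_vector transpose_transpose)
    with that show ?thesis by simp
  qed
  \<comment> \<open>\<open>x - p\<close> lies in both Null W and Range C, so it is B-orthogonal to
    itself.\<close>
  have intersect: "x = p" if "W *v x = W *v xstar" "x = xk + C *v y" for x y
  proof -
    have x: "x - p = C *v (y - yp)"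
      using that(2) yp by (simp add: matrix_vector_mult_diff_distrib)
    have "W *v (x - p) = 0"
      using that(1) Wp by (simp add: matrix_vector_mult_diff_distrib)
    from orth[OF this, of "y - yp"] have "(x - p) \<bullet> (B *v (x - p)) = 0"
      by (simp add: x)
    then show ?thesis
      using B unfolding sym_pos_def_def by (metis less_irrefl right_minus_eq)
  qed
  have 1: "is_arg_min (\<lambda>z. (norm_mat B (z - xk))\<^sup>2) (\<lambda>z. W *v z = transpose S *v b) x \<longleftrightarrow> x = p" for x
  proof (rule is_arg_min_norm_mat_iff[OF B])
    show "W *v p = transpose S *v b"
      by (simp only: Wp Sb)
    \<comment> \<open>Here \<open>z - p\<close> is in Null W and \<open>p - xk\<close> is
      \<open>C *v yp\<close>.\<close>
    show "(z - p) \<bullet> (B *v (p - xk)) = 0" if "W *v z = transpose S *v b" for z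
    proof -
      have "W *v (z - p) = 0"
        using that unfolding Sb by (simp add: Wp matrix_vector_mult_diff_distrib)
      then show ?thesis
        using orth yp by simp
    qed
  qed
  have 2: "is_arg_min (\<lambda>z. (norm_mat B (z - xstar))\<^sup>2) (\<lambda>z. \<exists>y. z = xk + C *v y) x \<longleftrightarrow> x = p" for x
  proof (rule is_arg_min_norm_mat_iff[OF B])
    show "\<exists>y. p = xk + C *v y"
      using yp by blast
    \<comment> \<open>The roles are swapped: \<open>z - p\<close> is in Range C and
      \<open>p - xstar\<close> in Null W, so \<open>orth\<close> applies after exchanging the
      arguments by symmetry of \<open>B\<close>.\<close>
    show "(z - p) \<bullet> (B *v (p - xstar)) = 0" if z: "\<exists>y. z = xk + C *v y" for z
    proof -
      obtain y where "z = xk + C *v y" using z by blast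
      then have "z - p = C *v (y - yp)"
        using yp by (simp add: matrix_vector_mult_diff_distrib)
      moreover have "W *v (p - xstar) = 0"
        by (simp add: Wp matrix_vector_mult_diff_distrib)
      ultimately have "(p - xstar) \<bullet> (B *v (z - p)) = 0"
        using orth by simp
      then show ?thesis
        using B unfolding sym_pos_def_def
        by (metis dot_lmul_matrix inner_commute transpose_matrix_vector)
    qed
  qed
  have 4: "(\<exists>y. W *v x = transpose S *v b \<and> x = xk + C *v y) \<longleftrightarrow> x = p" for x
    using intersect Wp yp by (metis Sb)
  have "(\<lambda>u. xstar + u) ` null_mat W = {x. W *v x = W *v xstar}"
  proof (intro set_eqI iffI)
    fix x assume "x \<in> {x. W *v x = W *v xstar}"
    then have "x - xstar \<in> null_mat W"
      by (simp add: null_mat_def matrix_vector_mult_diff_distrib)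
    then show "x \<in> (\<lambda>u. xstar + u) ` null_mat W"
      by (rule rev_image_eqI) simp
  qed (auto simp: null_mat_def matrix_vector_right_distrib)
  moreover have "(\<lambda>u. xk + u) ` range_mat C = {x. \<exists>y. x = xk + C *v y}"
    by (auto simp: range_mat_def)
  ultimately have "((\<lambda>u. xstar + u) ` null_mat W) \<inter> ((\<lambda>u. xk + u) ` range_mat C) = {p}"
    using intersect Wp yp by blast
  then have 3: "{x} = ((\<lambda>u. xstar + u) ` null_mat W) \<inter> ((\<lambda>u. xk + u) ` range_mat C) \<longleftrightarrow> x = p" for x
    by auto
  have "(C ** pinv M ** transpose S) *v (A *v xk - b) = C *v (pinv M *v (W *v (xk - xstar)))"
    by (simp add: W_def matrix_vector_mult_diff_distrib flip: matrix_vector_mul_assoc xstar)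
  then have 5: "x = xk - (C ** pinv M ** transpose S) *v (A *v xk - b) \<longleftrightarrow> x = p" for x
    by (simp add: p_def)
  \<comment> \<open>This identifies the matrix of the fixed point form with the one that defines
    \<open>p\<close>, after which only \<open>xstar\<close> has to be subtracted.\<close>
  have BiZ: "?Bi ** (transpose A ** S ** pinv M ** transpose S ** A) = C ** pinv M ** W"
    by (simp add: C_def W_def matrix_mul_assoc)
  have "(mat 1 - C ** pinv M ** W) *v (xk - xstar) = p - xstar"
    by (simp add: p_def matrix_vector_mult_diff_rdistrib del: matrix_vector_mult_diff_distrib
        flip: matrix_vector_mul_assoc)
  then have 6: "(let Z = transpose A ** S ** pinv M ** transpose S ** A
      in x - xstar = (mat 1 - ?Bi ** Z) *v (xk - xstar)) \<longleftrightarrow> x = p" for x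
    by (simp add: Let_def BiZ)
  note six = 1 2 3 4 5 6
  show ?thesis
    by (intro exI[of _ p] allI conjI six[unfolded W_def C_def M_def])
qed

end
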